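(* Let $A$ be a metric algebraic structure (with function symbols $\mathbf F$, terms $\mathbf T$, state symbols $\mathbf G$, metric $d$, domains $\mathbf D$, and set $\mathbf U$ of continuity symbols). Let $G_1,G_2$ be subsets of $A$ such that $G_1^{\mathbf T}=G_2^{\mathbf T}$. Then for every sequence $(A_r)_{r\ge1}$ of structures of the same type as $A$ and every positive normalization function $N(r)$ we have $$\dim(G_1)=\dim(G_2),$$ provided that the positive normalization function $L$ satisfies $$\lim_{\varepsilon\to0}\frac{L(\eta(c\varepsilon)/2)}{L(\varepsilon)}=1$$ (convergence is assumed) for every $\eta\in\mathbf U$ and every $c\in(0,1)$.
   Context: Structures. $A$ is a set with a set $\mathbf F$ of function symbols $f:A^n\to A$ ($n\ge 0$ the arity; constants are allowed). $\mathbf T$ is the set of terms: functions obtained by finite iterated composition of elements of $\mathbf F$ (variables, i.e. coordinate projections, count as terms). For $F\subset A$ and $T\subset\mathbf T$, $F^T\subset A$ is the set of all values obtained by applying elements of $T$ to elements of $F$; thus $F^{\mathbf T}$ is the substructure generated by $F$. $\mathbf G$ is a set of state symbols $g:A^n\to\mathbb R$, $n\ge1$. $A$ carries a metric $d$ and a family $\mathbf D$ of subsets (domains) exhausting $A$, each complete and bounded for $d$. It is not assumed that $d\in\mathbf G$. Uniform continuity: for every $t\in\mathbf T\cup\mathbf G$ of arity $n>0$ and all $D_1,\dots,D_n\in\mathbf D$ there is a given modulus $\eta=\eta_t^{D_1,\dots,D_n}:(0,1]\to(0,1]$ such that for each $1\le j\le n$, all $a_i\in D_i$ ($i\ne j$),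 all $a,b\in D_j$ and all $\varepsilon$: $d(a,b)<\eta(\varepsilon)$ implies $d\big(t(a_1,\dots,a_{j-1},a,a_{j+1},\dots,a_n),t(a_1,\dots,a_{j-1},b,a_{j+1},\dots,a_n)\big)<\varepsilon$ (in $\mathbb R$, $d$ is the usual distance). All of this data is a language (in the sense of continuous logic), of which $A$ is an interpretation; a structure $B$ of the same type as $A$ is another interpretation of the same function symbols, state symbols, metric, domains, with the same moduli of continuity. $\mathbf U$ is the set of all functions $\min_{t\in T}\eta_t^{D_1,\dots,D_n}:(0,1]\to(0,1]$ with $T\subset\mathbf T\cup\mathbf G$ finite consisting of $n$-ary elements ($n\geq 1$) and $D_1,\dots,D_n\in\mathbf D$. Microstates. Write $X\ll Y$ for "$X$ is a finite subset of $Y$". Let $B$ be a structure of the same type as $A$, $F\ll A$, $R\subset\mathbf T\cup\mathbf G$, $\delta\ge0$. A map $\sigma:F\to B$ is an $(R,\delta)$-microstate if (i) $d(\sigma(a_{n+1}),t(\sigma(a_1),\dots,\sigma(a_n)))\le\delta$ whenever $t\in R\cap\mathbf T$ and $a_1,\dots,a_{n+1}\in F$ satisfy $a_{n+1}=t(a_1,\dots,a_n)$; and (ii) $|g(a_1,\dots,a_n)-g(\sigma(a_1),\dots,\sigma(a_n))|\le\delta$ for all $g\in R\cap\mathbf G$, $a_1,\dots,a_n\in F$. It is domain preserving if, for every $a\in F$, $\sigma(a)$ lies in every domain that $a$ lies in. $\mathrm{MS}(F,R,\delta,B)$ is the set of domain preserving $(R,\delta)$-microstates $F\to B$. For $E\subset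 F$ put $d_E(\sigma,\tau)=\sup_{s\in E}d(\sigma(s),\tau(s))$, and let $N_{E,\varepsilon}(\cdot)$ be the maximal cardinality of an $\varepsilon$-separated subset with respect to $d_E$. Entropy dimension. For finite $E\subset F\subset A$, $R\ll\mathbf T\cup\mathbf G$, $\delta,\varepsilon>0$: $$h(E,F,R,\delta,\varepsilon)=\limsup_{r\to\infty}\frac{\log N_{E,\varepsilon}(\mathrm{MS}(F,R,\delta,A_r))}{N(r)}\quad(\log 0=-\infty).$$ For $B\subset A$ arbitrary and $E\ll B$: $h(E,B,\varepsilon)=\inf_{\delta>0}\inf_{R\ll\mathbf T\cup\mathbf G}\inf_{E\subset F\ll B}h(E,F,R,\delta,\varepsilon)$. For $G\subset A$: $$\dim(G)=\sup_{E\ll G}\limsup_{\varepsilon\to0}\frac{h(E,G^{\mathbf T},\varepsilon)}{L(\varepsilon)}.$$ *)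

theory Defs
  imports "HOL-Analysis.Analysis" "HOL-Library.Extended_Nat"
begin

datatype 'f trm = Var nat | App 'f "'f trm list"

text \<open>
  A term comes with an explicit arity \<open>n\<close>: \<open>TermSym n t\<close> is \<open>t\<close> regarded as a function symbol in the
  variables \<open>Var 0, ..., Var (n - 1)\<close>, some of which may be dummies.  In particular
  \<open>TermSym n (Var i)\<close> with \<open>i < n\<close> is a coordinate projection.
\<close>

datatype ('f, 'g) sym = TermSym nat "'f trm" | StateSym 'g

text \<open>
  The language: function, state and domain symbols, and for every symbol \<open>s\<close> in \<open>T \<union> G\<close> of arity
  \<open>n > 0\<close> and every list \<open>Ds\<close> of \<open>n\<close> domain symbols a modulus of continuity \<open>modulus s Ds\<close>, of which
  only the values on \<open>(0,1]\<close> matter.  Domains are symbols because the same domain symbol is interpreted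
  in all structures of a given type.
\<close>

record ('f, 'g, 'D) lang =
  funs :: "'f set"
  fun_arity :: "'f \<Rightarrow> nat"
  states :: "'g set"
  state_arity :: "'g \<Rightarrow> nat"
  doms :: "'D set"
  modulus :: "('f, 'g) sym \<Rightarrow> 'D list \<Rightarrow> real \<Rightarrow> real"

record ('f, 'g, 'D, 'a) struct =
  univ :: "'a set"
  mdist :: "'a \<Rightarrow> 'a \<Rightarrow> real"
  fun_int :: "'f \<Rightarrow> 'a list \<Rightarrow> 'a"
  state_int :: "'g \<Rightarrow> 'a list \<Rightarrow> real"
  dom_int :: "'D \<Rightarrow> 'a set"

primrec wf_trm :: "('f, 'g, 'D) lang \<Rightarrow> nat \<Rightarrow> 'f trm \<Rightarrow> bool" where
  "wf_trm \<L> n (Var i) \<longleftrightarrow> i < n"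
| "wf_trm \<L> n (App f ts) \<longleftrightarrow>
     f \<in> funs \<L> \<and> length ts = fun_arity \<L> f \<and> list_all (wf_trm \<L> n) ts"

definition term_syms :: "('f, 'g, 'D) lang \<Rightarrow> ('f, 'g) sym set" where
  "term_syms \<L> = {TermSym n t | n t. wf_trm \<L> n t}"

definition syms :: "('f, 'g, 'D) lang \<Rightarrow> ('f, 'g) sym set" where
  "syms \<L> = term_syms \<L> \<union> StateSym ` states \<L>"

fun sym_arity :: "('f, 'g, 'D) lang \<Rightarrow> ('f, 'g) sym \<Rightarrow> nat" where
  "sym_arity \<L> (TermSym n t) = n"
| "sym_arity \<L> (StateSym g) = state_arity \<L> g"

definition is_language :: "('f, 'g, 'D) lang \<Rightarrow> bool" where
  "is_language \<L> \<longleftrightarrow>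
     (\<forall>g\<in>states \<L>. state_arity \<L> g \<ge> 1) \<and>
     (\<forall>s\<in>syms \<L>. \<forall>Ds. sym_arity \<L> s > 0 \<and> length Ds = sym_arity \<L> s \<and> set Ds \<subseteq> doms \<L> \<longrightarrow>
        modulus \<L> s Ds \<in> {0<..1} \<rightarrow> {0<..1})"

primrec eval_trm :: "('f, 'g, 'D, 'a) struct \<Rightarrow> 'a list \<Rightarrow> 'f trm \<Rightarrow> 'a" where
  "eval_trm S xs (Var i) = xs ! i"
| "eval_trm S xs (App f ts) = fun_int S f (map (eval_trm S xs) ts)"

text \<open>
  \<open>mod_cont S Ds \<eta> \<rho> h\<close>: the function \<open>h\<close> of \<open>length Ds\<close> arguments is uniformly continuous in each
  argument on the domains \<open>Ds\<close>, with modulus \<open>\<eta>\<close>; distances of values are measured by \<open>\<rho>\<close>.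
\<close>

definition mod_cont ::
  "('f, 'g, 'D, 'a) struct \<Rightarrow> 'D list \<Rightarrow> (real \<Rightarrow> real) \<Rightarrow> ('b \<Rightarrow> 'b \<Rightarrow> real) \<Rightarrow> ('a list \<Rightarrow> 'b) \<Rightarrow> bool" where
  "mod_cont S Ds \<eta> \<rho> h \<longleftrightarrow>
     (\<forall>j<length Ds. \<forall>xs b. \<forall>\<epsilon>\<in>{0<..1}.
        length xs = length Ds \<and> (\<forall>i<length Ds. xs ! i \<in> dom_int S (Ds ! i)) \<and>
        b \<in> dom_int S (Ds ! j) \<and> mdist S (xs ! j) b < \<eta> \<epsilon> \<longrightarrow>
        \<rho> (h xs) (h (xs[j := b])) < \<epsilon>)"

definition is_structure :: "('f, 'g, 'D) lang \<Rightarrow> ('f, 'g, 'D, 'a) struct \<Rightarrow> bool" where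
  "is_structure \<L> S \<longleftrightarrow>
     Metric_space (univ S) (mdist S) \<and>
     (\<forall>f\<in>funs \<L>. \<forall>xs. length xs = fun_arity \<L> f \<and> set xs \<subseteq> univ S \<longrightarrow> fun_int S f xs \<in> univ S) \<and>
     (\<Union>D\<in>doms \<L>. dom_int S D) = univ S \<and>
     (\<forall>D\<in>doms \<L>. Metric_space.mcomplete (dom_int S D) (mdist S) \<and>
                  Metric_space.mbounded (univ S) (mdist S) (dom_int S D)) \<and>
     (\<forall>n t Ds. TermSym n t \<in> syms \<L> \<and> n > 0 \<and> length Ds = n \<and> set Ds \<subseteq> doms \<L> \<longrightarrow>
        mod_cont S Ds (modulus \<L> (TermSym n t) Ds) (mdist S) (\<lambda>xs. eval_trm S xs t)) \<and>
     (\<forall>g Ds. StateSym g \<in> syms \<L> \<and> length Ds = state_arity \<L> g \<and> set Ds \<subseteq> doms \<L> \<longrightarrow>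
        mod_cont S Ds (modulus \<L> (StateSym g) Ds) dist (state_int S g))"

text \<open>\<open>F\<^sup>T\<close>; applied to nullary terms it also yields the constants.\<close>

definition values_of ::
  "('f, 'g, 'D, 'a) struct \<Rightarrow> ('f, 'g) sym set \<Rightarrow> 'a set \<Rightarrow> 'a set" where
  "values_of S T F = {eval_trm S xs t | n t xs. TermSym n t \<in> T \<and> length xs = n \<and> set xs \<subseteq> F}"

definition continuity_symbols :: "('f, 'g, 'D) lang \<Rightarrow> (real \<Rightarrow> real) set" where
  "continuity_symbols \<L> =
     {\<lambda>\<epsilon>. Min ((\<lambda>s. modulus \<L> s Ds \<epsilon>) ` T) | T Ds n.
        n \<ge> 1 \<and> finite T \<and> T \<noteq> {} \<and> T \<subseteq> syms \<L> \<and> (\<forall>s\<in>T. sym_arity \<L> s = n) \<and>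
        length Ds = n \<and> set Ds \<subseteq> doms \<L>}"

definition microstate ::
  "('f, 'g, 'D) lang \<Rightarrow> ('f, 'g, 'D, 'a) struct \<Rightarrow> 'a set \<Rightarrow> ('f, 'g) sym set \<Rightarrow> real \<Rightarrow>
   ('f, 'g, 'D, 'b) struct \<Rightarrow> ('a \<Rightarrow> 'b) \<Rightarrow> bool" where
  "microstate \<L> A F R \<delta> B \<sigma> \<longleftrightarrow>
     (\<forall>n t xs a. TermSym n t \<in> R \<and> length xs = n \<and> set xs \<subseteq> F \<and> a \<in> F \<and> a = eval_trm A xs t \<longrightarrow>
        mdist B (\<sigma> a) (eval_trm B (map \<sigma> xs) t) \<le> \<delta>) \<and>
     (\<forall>g xs. StateSym g \<in> R \<and> length xs = state_arity \<L> g \<and> set xs \<subseteq> F \<longrightarrow>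
        \<bar>state_int A g xs - state_int B g (map \<sigma> xs)\<bar> \<le> \<delta>)"

definition domain_preserving ::
  "('f, 'g, 'D) lang \<Rightarrow> ('f, 'g, 'D, 'a) struct \<Rightarrow> 'a set \<Rightarrow>
   ('f, 'g, 'D, 'b) struct \<Rightarrow> ('a \<Rightarrow> 'b) \<Rightarrow> bool" where
  "domain_preserving \<L> A F B \<sigma> \<longleftrightarrow>
     (\<forall>a\<in>F. \<forall>D\<in>doms \<L>. a \<in> dom_int A D \<longrightarrow> \<sigma> a \<in> dom_int B D)"

definition MS ::
  "('f, 'g, 'D) lang \<Rightarrow> ('f, 'g, 'D, 'a) struct \<Rightarrow> 'a set \<Rightarrow> ('f, 'g) sym set \<Rightarrow> real \<Rightarrow>
   ('f, 'g, 'D, 'b) struct \<Rightarrow> ('a \<Rightarrow> 'b) set" where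
  "MS \<L> A F R \<delta> B =
     {\<sigma> \<in> F \<rightarrow>\<^sub>E univ B. microstate \<L> A F R \<delta> B \<sigma> \<and> domain_preserving \<L> A F B \<sigma>}"

text \<open>Inserting \<open>0\<close> gives the supremum over the empty set its value in \<open>[0,\<infinity>]\<close>.\<close>

definition dist_on ::
  "('f, 'g, 'D, 'b) struct \<Rightarrow> 'a set \<Rightarrow> ('a \<Rightarrow> 'b) \<Rightarrow> ('a \<Rightarrow> 'b) \<Rightarrow> real" where
  "dist_on B E \<sigma> \<tau> = Sup (insert 0 ((\<lambda>s. mdist B (\<sigma> s) (\<tau> s)) ` E))"

definition separated :: "('c \<Rightarrow> 'c \<Rightarrow> real) \<Rightarrow> real \<Rightarrow> 'c set \<Rightarrow> bool" where
  "separated \<rho> \<epsilon> X \<longleftrightarrow> (\<forall>x\<in>X. \<forall>y\<in>X. x \<noteq> y \<longrightarrow> \<rho> x y \<ge> \<epsilon>)"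

text \<open>The value is \<open>\<infinity>\<close> if there are separated subsets of arbitrarily large cardinality.\<close>

definition sep_num :: "('c \<Rightarrow> 'c \<Rightarrow> real) \<Rightarrow> real \<Rightarrow> 'c set \<Rightarrow> enat" where
  "sep_num \<rho> \<epsilon> M =
     (SUP X\<in>{X. X \<subseteq> M \<and> separated \<rho> \<epsilon> X}. if finite X then enat (card X) else \<infinity>)"

fun log_enat :: "enat \<Rightarrow> ereal" where
  "log_enat (enat k) = (if k = 0 then - \<infinity> else ereal (ln (real k)))"
| "log_enat \<infinity> = \<infinity>"

definition h_loc ::
  "('f, 'g, 'D) lang \<Rightarrow> ('f, 'g, 'D, 'a) struct \<Rightarrow> (nat \<Rightarrow> ('f, 'g, 'D, 'b) struct) \<Rightarrow> (nat \<Rightarrow> real) \<Rightarrow>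
   'a set \<Rightarrow> 'a set \<Rightarrow> ('f, 'g) sym set \<Rightarrow> real \<Rightarrow> real \<Rightarrow> ereal" where
  "h_loc \<L> A As N E F R \<delta> \<epsilon> =
     limsup (\<lambda>r. log_enat (sep_num (dist_on (As r) E) \<epsilon> (MS \<L> A F R \<delta> (As r))) / ereal (N r))"

definition h_ent ::
  "('f, 'g, 'D) lang \<Rightarrow> ('f, 'g, 'D, 'a) struct \<Rightarrow> (nat \<Rightarrow> ('f, 'g, 'D, 'b) struct) \<Rightarrow> (nat \<Rightarrow> real) \<Rightarrow>
   'a set \<Rightarrow> 'a set \<Rightarrow> real \<Rightarrow> ereal" where
  "h_ent \<L> A As N E B \<epsilon> =
     (INF \<delta>\<in>{0<..}. INF R\<in>{R. finite R \<and> R \<subseteq> syms \<L>}. INF F\<in>{F. finite F \<and> E \<subseteq> F \<and> F \<subseteq> B}.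
        h_loc \<L> A As N E F R \<delta> \<epsilon>)"

definition entropy_dim ::
  "('f, 'g, 'D) lang \<Rightarrow> ('f, 'g, 'D, 'a) struct \<Rightarrow> (nat \<Rightarrow> ('f, 'g, 'D, 'b) struct) \<Rightarrow> (nat \<Rightarrow> real) \<Rightarrow>
   (real \<Rightarrow> real) \<Rightarrow> 'a set \<Rightarrow> ereal" where
  "entropy_dim \<L> A As N L G =
     (SUP E\<in>{E. finite E \<and> E \<subseteq> G}.
        Limsup (at_right 0) (\<lambda>\<epsilon>. h_ent \<L> A As N E (values_of A (term_syms \<L>) G) \<epsilon> / ereal (L \<epsilon>)))"

end

theory Submission
  imports Defs
begin

text \<open>
  Let \<open>E\<close> be a finite subset of \<open>G\<^sub>1\<close>. Its elements are values of finitely many terms at a common tuple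
  \<open>z\<^sub>1, ..., z\<^sub>n\<close> of elements of \<open>G\<^sub>2\<close>. With these terms among the relations and \<open>\<delta> \<le> \<epsilon> / 4\<close>, a microstate
  is determined on \<open>E\<close> up to \<open>\<epsilon> / 4\<close> by its values at the \<open>z\<^sub>i\<close>; so if \<open>\<eta>\<close> is a common modulus of continuity
  of the terms and \<open>c = 1 / (2 n)\<close>, two microstates that are \<open>\<epsilon>\<close>-apart on \<open>E\<close> are \<open>\<eta> (c \<epsilon>)\<close>-apart on
  \<open>{z\<^sub>1, ..., z\<^sub>n}\<close>. Hence \<open>h(E, B, \<epsilon>) \<le> h({z\<^sub>1, ..., z\<^sub>n}, B, \<eta> (c \<epsilon>) / 2)\<close> for the common substructure \<open>B\<close>,
  and the hypothesis on \<open>L\<close> makes the two scales indistinguishable.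
\<close>

section \<open>Terms and generated substructures\<close>

text \<open>Each variable is redirected to a position of \<open>zs\<close> that holds the same
  element. Terms evaluated at different tuples can thus be evaluated at one common tuple, with dummy
  variables where necessary.\<close>

lemma wf_trm_rename:
  assumes "wf_trm \<L> n t" "length xs = n" "set xs \<subseteq> set zs"
  shows "\<exists>t'. wf_trm \<L> (length zs) t' \<and> eval_trm S zs t' = eval_trm S xs t"
  using assms(1)
proof (induction t)
  case (Var i)
  then have "xs ! i \<in> set zs" using assms by auto
  then obtain j where "j < length zs" "zs ! j = xs ! i" by (auto simp: in_set_conv_nth)
  then show ?case by (intro exI[of _ "Var j"]) simp
next
  case (App f ts)
  then have "\<forall>t\<in>set ts. \<exists>t'. wf_trm \<L> (length zs) t' \<and> eval_trm S zs t' = eval_trm S xs t"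
    by (auto simp: list_all_iff)
  then obtain u where "\<And>t. t \<in> set ts \<Longrightarrow> wf_trm \<L> (length zs) (u t) \<and> eval_trm S zs (u t) = eval_trm S xs t"
    by metis
  then show ?case using App.prems
    by (intro exI[of _ "App f (map u ts)"]) (auto simp: list_all_iff comp_def cong: map_cong)
qed

lemma eval_trm_in_univ:
  assumes "is_structure \<L> S" "wf_trm \<L> n t" "length xs = n" "set xs \<subseteq> univ S"
  shows "eval_trm S xs t \<in> univ S"
  using assms(2)
proof (induction t)
  case (Var i)
  then show ?case using assms by auto
next
  case (App f ts)
  then have "set (map (eval_trm S xs) ts) \<subseteq> univ S" by (auto simp: list_all_iff)
  then show ?case using App.prems assms(1) by (simp add: is_structure_def)
qed

lemma subset_values_of: "G \<subseteq> values_of S (term_syms \<L>) G"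
proof
  fix x assume "x \<in> G"
  then show "x \<in> values_of S (term_syms \<L>) G"
    unfolding values_of_def term_syms_def
    by (auto intro!: exI[of _ "Suc 0"] exI[of _ "Var 0"] exI[of _ "[x]"])
qed

text \<open>The list \<open>zs\<close> collects the arguments used for all elements of
  \<open>E\<close>, and the terms are renamed to it. It is empty if only nullary terms are used, a
  case that later needs separate treatment.\<close>

lemma finite_generating_list:
  assumes "finite E" "E \<subseteq> values_of S (term_syms \<L>) G"
  obtains zs t where "set zs \<subseteq> G"
    "\<And>e. e \<in> E \<Longrightarrow> wf_trm \<L> (length zs) (t e) \<and> eval_trm S zs (t e) = e"
proof -
  have "\<forall>e\<in>E. \<exists>t xs. wf_trm \<L> (length xs) t \<and> set xs \<subseteq> G \<and> eval_trm S xs t = e"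
    using assms(2) unfolding values_of_def term_syms_def by blast
  then obtain t xs where tx: "\<And>e. e \<in> E \<Longrightarrow>
      wf_trm \<L> (length (xs e)) (t e) \<and> set (xs e) \<subseteq> G \<and> eval_trm S (xs e) (t e) = e"
    by metis
  have "finite (\<Union>e\<in>E. set (xs e))" using assms(1) by auto
  then obtain zs where zs: "set zs = (\<Union>e\<in>E. set (xs e))" using finite_list by blast
  have "\<exists>t'. wf_trm \<L> (length zs) t' \<and> eval_trm S zs t' = e" if "e \<in> E" for e
    using wf_trm_rename[of \<L> "length (xs e)" "t e" "xs e" zs S] tx[OF that] zs that by auto
  then obtain t' where "\<And>e. e \<in> E \<Longrightarrow> wf_trm \<L> (length zs) (t' e) \<and> eval_trm S zs (t' e) = e"
    by metis
  moreover have "set zs \<subseteq> G" using zs tx by blast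
  ultimately show thesis using that by blast
qed

section \<open>Uniform continuity of terms in all arguments jointly\<close>

lemma dom_int_subset_univ:
  assumes "is_structure \<L> S" "D \<in> doms \<L>"
  shows "dom_int S D \<subseteq> univ S"
  using assms unfolding is_structure_def by blast

text \<open>Moving one argument at a time costs \<open>\<epsilon>\<close> per step.\<close>

lemma eval_trm_dist_less:
  assumes S: "is_structure \<L> S" and t: "wf_trm \<L> n t" and n: "n > 0"
    and Ds: "length Ds = n" "set Ds \<subseteq> doms \<L>"
    and xs: "length xs = n" "\<And>i. i < n \<Longrightarrow> xs ! i \<in> dom_int S (Ds ! i)"
    and ys: "length ys = n" "\<And>i. i < n \<Longrightarrow> ys ! i \<in> dom_int S (Ds ! i)"
    and \<epsilon>: "\<epsilon> \<in> {0<..1}"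
    and close: "\<And>i. i < n \<Longrightarrow> mdist S (xs ! i) (ys ! i) < modulus \<L> (TermSym n t) Ds \<epsilon>"
  shows "mdist S (eval_trm S xs t) (eval_trm S ys t) < real n * \<epsilon>"
proof -
  interpret Metric_space "univ S" "mdist S" using S by (simp add: is_structure_def)
  have cont: "mod_cont S Ds (modulus \<L> (TermSym n t) Ds) (mdist S) (\<lambda>xs. eval_trm S xs t)"
    using S t n Ds unfolding is_structure_def syms_def term_syms_def by blast
  \<comment> \<open>The tuple \<open>zs k\<close> takes its first \<open>k\<close> entries from
    \<open>ys\<close> and the others from \<open>xs\<close>, so \<open>zs k\<close> and
    \<open>zs (Suc k)\<close> differ at most in entry \<open>k\<close>.\<close>
  define zs where "zs k = take k ys @ drop k xs" for k
  have len: "length (zs k) = n" if "k \<le> n" for k using that xs ys by (simp add: zs_def)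
  have nth: "zs k ! i = (if i < k then ys ! i else xs ! i)" if "k \<le> n" "i < n" for k i
    using that xs ys by (auto simp: zs_def nth_append)
  have dom: "zs k ! i \<in> dom_int S (Ds ! i)" if "k \<le> n" "i < n" for k i
    using nth that xs ys by simp
  have univ: "eval_trm S (zs k) t \<in> univ S" if "k \<le> n" for k
  proof (rule eval_trm_in_univ[OF S t len[OF that]])
    show "set (zs k) \<subseteq> univ S"
      using dom[OF that] len[OF that] dom_int_subset_univ[OF S] Ds
      by (fastforce simp: in_set_conv_nth)
  qed
  have step: "mdist S (eval_trm S (zs k) t) (eval_trm S (zs (Suc k)) t) < \<epsilon>" if "k < n" for k
  proof -
    have "zs (Suc k) = (zs k)[k := ys ! k]"
      using that nth len by (intro nth_equalityI) (auto simp: nth_list_update less_Suc_eq)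
    then show ?thesis
      using cont \<epsilon> that dom[of k] len[of k] nth[of k k] ys close[OF that] Ds
      unfolding mod_cont_def by auto
  qed
  \<comment> \<open>Strictness can only be claimed for \<open>k > 0\<close>, since both sides vanish
    at \<open>k = 0\<close>; as \<open>n > 0\<close>, it is available at the end.\<close>
  have "k \<le> n \<Longrightarrow> mdist S (eval_trm S xs t) (eval_trm S (zs k) t) \<le> real k * \<epsilon> \<and>
      (k > 0 \<longrightarrow> mdist S (eval_trm S xs t) (eval_trm S (zs k) t) < real k * \<epsilon>)" for k
  proof (induction k)
    case 0
    have "zs 0 = xs" by (simp add: zs_def)
    then show ?case using univ[of 0] by simp
  next
    case (Suc k)
    have "eval_trm S xs t \<in> univ S" using univ[of 0] by (simp add: zs_def)
    then have "mdist S (eval_trm S xs t) (eval_trm S (zs (Suc k)) t) \<le>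
        mdist S (eval_trm S xs t) (eval_trm S (zs k) t) +
        mdist S (eval_trm S (zs k) t) (eval_trm S (zs (Suc k)) t)"
      using triangle univ Suc.prems by simp
    then show ?case using Suc step[of k] by (auto simp: algebra_simps)
  qed
  from this[of n] show ?thesis using n xs ys by (simp add: zs_def)
qed

section \<open>Microstates and their distances on finite sets\<close>

lemma mdist_le_dist_on:
  assumes "finite E" "s \<in> E"
  shows "mdist B (\<sigma> s) (\<tau> s) \<le> dist_on B E \<sigma> \<tau>"
  unfolding dist_on_def using assms by (intro cSup_upper) auto

text \<open>A finite supremum is a maximum, and \<epsilon> > 0 excludes the inserted value 0. In
  particular, the assumptions are contradictory for empty \<open>E\<close>.\<close>

lemma dist_on_attained:
  assumes "finite E" "\<epsilon> > 0" "dist_on B E \<sigma> \<tau> \<ge> \<epsilon>"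
  obtains s where "s \<in> E" "mdist B (\<sigma> s) (\<tau> s) \<ge> \<epsilon>"
proof -
  let ?D = "insert 0 ((\<lambda>s. mdist B (\<sigma> s) (\<tau> s)) ` E)"
  have "finite ?D" "?D \<noteq> {}" using assms(1) by auto
  then have "dist_on B E \<sigma> \<tau> \<in> ?D" unfolding dist_on_def using cSup_eq_Max Max_in by metis
  then show thesis using assms(2,3) that by auto
qed

lemma microstate_dist_eval:
  assumes "\<sigma> \<in> MS \<L> A F R \<delta> B" "TermSym (length zs) t \<in> R" "set zs \<subseteq> F" "eval_trm A zs t \<in> F"
  shows "mdist B (\<sigma> (eval_trm A zs t)) (eval_trm B (map \<sigma> zs) t) \<le> \<delta>"
  using assms unfolding MS_def microstate_def by blast

lemma MS_in_univ: "\<sigma> \<in> MS \<L> A F R \<delta> B \<Longrightarrow> a \<in> F \<Longrightarrow> \<sigma> a \<in> univ B"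
  by (auto simp: MS_def)

text \<open>Fewer points, fewer relations and a larger tolerance all weaken the conditions on a
  microstate. The map has to be restricted because the elements of \<open>MS\<close> are extensional
  functions.\<close>

lemma restrict_MS:
  assumes "\<sigma> \<in> MS \<L> A F' R' \<delta>' B" "F \<subseteq> F'" "R \<subseteq> R'" "\<delta>' \<le> \<delta>"
  shows "restrict \<sigma> F \<in> MS \<L> A F R \<delta> B"
proof -
  have map_eq: "map (restrict \<sigma> F) xs = map \<sigma> xs" if "set xs \<subseteq> F" for xs
    using that by (auto intro!: map_cong)
  have ms: "microstate \<L> A F' R' \<delta>' B \<sigma>" and dp: "domain_preserving \<L> A F' B \<sigma>"
    and range: "\<sigma> \<in> F' \<rightarrow> univ B"
    using assms(1) by (auto simp: MS_def)
  have "microstate \<L> A F R \<delta> B (restrict \<sigma> F)"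
    unfolding microstate_def
  proof (intro conjI allI impI; elim conjE)
    fix n t xs a
    assume *: "TermSym n t \<in> R" "length xs = n" "set xs \<subseteq> F" "a \<in> F" "a = eval_trm A xs t"
    then have "mdist B (\<sigma> a) (eval_trm B (map \<sigma> xs) t) \<le> \<delta>'"
      using ms assms(2,3) unfolding microstate_def by blast
    then show "mdist B (restrict \<sigma> F a) (eval_trm B (map (restrict \<sigma> F) xs) t) \<le> \<delta>"
      using * assms(4) by (simp add: map_eq)
  next
    fix g xs
    assume *: "StateSym g \<in> R" "length xs = state_arity \<L> g" "set xs \<subseteq> F"
    then have "\<bar>state_int A g xs - state_int B g (map \<sigma> xs)\<bar> \<le> \<delta>'"
      using ms assms(2,3) unfolding microstate_def by blast
    then show "\<bar>state_int A g xs - state_int B g (map (restrict \<sigma> F) xs)\<bar> \<le> \<delta>"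
      using * assms(4) by (simp add: map_eq)
  qed
  moreover have "domain_preserving \<L> A F B (restrict \<sigma> F)"
    using dp assms(2) unfolding domain_preserving_def by auto
  ultimately show ?thesis
    using range assms(2) by (auto simp: MS_def)
qed

lemma dist_on_restrict: "E \<subseteq> F \<Longrightarrow> dist_on B E (restrict \<sigma> F) (restrict \<tau> F) = dist_on B E \<sigma> \<tau>"
  unfolding dist_on_def by (intro arg_cong[of _ _ Sup] arg_cong[of _ _ "insert 0"] image_cong) auto

text \<open>Used to see that maps at positive distance are distinct. The values must lie in
  \<open>univ B\<close>, as \<open>mdist\<close> is only known to vanish on the diagonal
  there.\<close>

lemma dist_on_self:
  assumes "is_structure \<L> B" "\<sigma> ` E \<subseteq> univ B"
  shows "dist_on B E \<sigma> \<sigma> = 0"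
proof -
  interpret Metric_space "univ B" "mdist B" using assms(1) by (simp add: is_structure_def)
  have "insert 0 ((\<lambda>s. mdist B (\<sigma> s) (\<sigma> s)) ` E) = {0}" using assms(2) by auto
  then show ?thesis unfolding dist_on_def by (simp only: cSup_singleton)
qed

section \<open>Comparison of separation numbers and entropies\<close>

text \<open>The map \<open>f\<close> carries separated sets injectively to separated sets, so
  cardinalities are preserved, infinite ones included. Distinctness of the images is a separate
  assumption because \<open>\<rho>'\<close> is an arbitrary function that might be large on the
  diagonal.\<close>

lemma sep_num_le:
  assumes "f ` M \<subseteq> M'"
    and "\<And>x y. x \<in> M \<Longrightarrow> y \<in> M \<Longrightarrow> \<rho> x y \<ge> \<epsilon> \<Longrightarrow> \<rho>' (f x) (f y) \<ge> \<epsilon>'"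
    and "\<And>x y. x \<in> M \<Longrightarrow> y \<in> M \<Longrightarrow> \<rho> x y \<ge> \<epsilon> \<Longrightarrow> f x \<noteq> f y"
  shows "sep_num \<rho> \<epsilon> M \<le> sep_num \<rho>' \<epsilon>' M'"
  unfolding sep_num_def
proof (rule SUP_least)
  fix X assume "X \<in> {X. X \<subseteq> M \<and> separated \<rho> \<epsilon> X}"
  then have X: "X \<subseteq> M" "separated \<rho> \<epsilon> X" by auto
  then have sep: "separated \<rho>' \<epsilon>' (f ` X)"
    unfolding separated_def by (auto intro!: assms(2))
  have inj: "inj_on f X"
    using X assms(3) unfolding separated_def inj_on_def by blast
  show "(if finite X then enat (card X) else \<infinity>) \<le>
      (SUP X\<in>{X. X \<subseteq> M' \<and> separated \<rho>' \<epsilon>' X}. if finite X then enat (card X) else \<infinity>)"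
    using X sep assms(1) inj
    by (intro SUP_upper2[of "f ` X"]) (auto simp: card_image finite_image_iff)
qed

lemma log_enat_mono: "m \<le> n \<Longrightarrow> log_enat m \<le> log_enat n"
  by (cases m; cases n) auto

text \<open>The upper limit ignores r = 0, about which nothing is assumed; positivity of
  \<open>N r\<close> makes the division monotone.\<close>

lemma h_loc_mono:
  assumes "\<And>r. r \<ge> 1 \<Longrightarrow> N r > 0"
    and "\<And>r. r \<ge> 1 \<Longrightarrow> sep_num (dist_on (As r) E) \<epsilon> (MS \<L> A F R \<delta> (As r)) \<le>
          sep_num (dist_on (As r) E') \<epsilon>' (MS \<L> A F' R' \<delta>' (As r))"
  shows "h_loc \<L> A As N E F R \<delta> \<epsilon> \<le> h_loc \<L> A As N E' F' R' \<delta>' \<epsilon>'"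
  unfolding h_loc_def
proof (rule Limsup_mono, rule eventually_mono[OF eventually_ge_at_top[of "1::nat"]])
  fix r :: nat assume r: "1 \<le> r"
  then show "log_enat (sep_num (dist_on (As r) E) \<epsilon> (MS \<L> A F R \<delta> (As r))) / ereal (N r) \<le>
      log_enat (sep_num (dist_on (As r) E') \<epsilon>' (MS \<L> A F' R' \<delta>' (As r))) / ereal (N r)"
    using assms by (intro ereal_divide_right_mono log_enat_mono) auto
qed

text \<open>The nested infima act as one infimum over triples \<open>(\<delta>, R, F)\<close>, so
  the new parameters may each depend on all the old ones.\<close>

lemma h_ent_le:
  assumes "\<And>\<delta> R F. \<delta> > 0 \<Longrightarrow> finite R \<Longrightarrow> R \<subseteq> syms \<L> \<Longrightarrow> finite F \<Longrightarrow> E' \<subseteq> F \<Longrightarrow> F \<subseteq> B \<Longrightarrow>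
     \<exists>\<delta>' R' F'. \<delta>' > 0 \<and> finite R' \<and> R' \<subseteq> syms \<L> \<and> finite F' \<and> E \<subseteq> F' \<and> F' \<subseteq> B \<and>
       h_loc \<L> A As N E F' R' \<delta>' \<epsilon> \<le> h_loc \<L> A As N E' F R \<delta> \<epsilon>'"
  shows "h_ent \<L> A As N E B \<epsilon> \<le> h_ent \<L> A As N E' B \<epsilon>'"
  unfolding h_ent_def[of \<L> A As N E' B \<epsilon>']
proof (intro INF_greatest)
  fix \<delta> :: real and R F
  assume "\<delta> \<in> {0<..}" "R \<in> {R. finite R \<and> R \<subseteq> syms \<L>}" "F \<in> {F. finite F \<and> E' \<subseteq> F \<and> F \<subseteq> B}"
  then obtain \<delta>' R' F' where *: "\<delta>' > 0" "finite R'" "R' \<subseteq> syms \<L>" "finite F'" "E \<subseteq> F'" "F' \<subseteq> B"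
    and le: "h_loc \<L> A As N E F' R' \<delta>' \<epsilon> \<le> h_loc \<L> A As N E' F R \<delta> \<epsilon>'"
    using assms by (smt (verit) greaterThan_iff mem_Collect_eq)
  have "h_ent \<L> A As N E B \<epsilon> \<le> h_loc \<L> A As N E F' R' \<delta>' \<epsilon>"
    unfolding h_ent_def
    by (rule INF_lower2[of \<delta>'], use * in simp, rule INF_lower2[of R'], use * in simp,
        rule INF_lower, use * in simp)
  with le show "h_ent \<L> A As N E B \<epsilon> \<le> h_loc \<L> A As N E' F R \<delta> \<epsilon>'" by order
qed

text \<open>A set that is \<epsilon>-separated is \<epsilon>'-separated for every smaller
  \<epsilon>', so the identity serves as the comparison map.\<close>

lemma h_ent_antimono:
  assumes N: "\<And>r. r \<ge> 1 \<Longrightarrow> N r > 0" and As: "\<And>r. r \<ge> 1 \<Longrightarrow> is_structure \<L> (As r)"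
    and "0 < \<epsilon>'" "\<epsilon>' \<le> \<epsilon>"
  shows "h_ent \<L> A As N E B \<epsilon> \<le> h_ent \<L> A As N E B \<epsilon>'"
proof (rule h_ent_le, intro exI conjI)
  fix \<delta> :: real and R F
  assume "E \<subseteq> F"
  show "h_loc \<L> A As N E F R \<delta> \<epsilon> \<le> h_loc \<L> A As N E F R \<delta> \<epsilon>'"
  proof (rule h_loc_mono[OF N])
    fix r :: nat assume r: "1 \<le> r"
    show "sep_num (dist_on (As r) E) \<epsilon> (MS \<L> A F R \<delta> (As r)) \<le> sep_num (dist_on (As r) E) \<epsilon>' (MS \<L> A F R \<delta> (As r))"
    proof (rule sep_num_le[where f = id])
      fix \<sigma> \<tau> assume \<sigma>: "\<sigma> \<in> MS \<L> A F R \<delta> (As r)" and "\<epsilon> \<le> dist_on (As r) E \<sigma> \<tau>"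
      moreover have "dist_on (As r) E \<sigma> \<sigma> = 0"
        using dist_on_self[OF As[OF r]] MS_in_univ[OF \<sigma>] \<open>E \<subseteq> F\<close> by (metis image_subsetI subsetD)
      ultimately show "id \<sigma> \<noteq> id \<tau>" using assms by auto
    qed (use assms in auto)
  qed
qed auto

text \<open>Given parameters for \<open>E'\<close>, those for \<open>E\<close> are obtained by
  adding \<open>E\<close> to \<open>F\<close> and \<open>R0\<close> to \<open>R\<close> and by
  capping \<delta> at \<open>\<delta>0\<close>. Restriction to \<open>F\<close> then maps the
  microstates back, and \<open>sep\<close> says that it turns separation on \<open>E\<close> into
  separation on \<open>E'\<close>.\<close>

lemma h_ent_transfer:
  assumes N: "\<And>r. r \<ge> 1 \<Longrightarrow> N r > 0" and As: "\<And>r. r \<ge> 1 \<Longrightarrow> is_structure \<L> (As r)"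
    and E: "finite E" "E \<subseteq> B" and "\<epsilon>' > 0"
    and R0: "finite R0" "R0 \<subseteq> syms \<L>" and \<delta>0: "\<delta>0 > 0"
    and sep: "\<And>r F R \<delta> \<sigma> \<tau>. r \<ge> 1 \<Longrightarrow> E \<union> E' \<subseteq> F \<Longrightarrow> R0 \<subseteq> R \<Longrightarrow> \<delta> \<le> \<delta>0 \<Longrightarrow>
        \<sigma> \<in> MS \<L> A F R \<delta> (As r) \<Longrightarrow> \<tau> \<in> MS \<L> A F R \<delta> (As r) \<Longrightarrow>
        dist_on (As r) E \<sigma> \<tau> \<ge> \<epsilon> \<Longrightarrow> dist_on (As r) E' \<sigma> \<tau> \<ge> \<epsilon>'"
  shows "h_ent \<L> A As N E B \<epsilon> \<le> h_ent \<L> A As N E' B \<epsilon>'"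
proof (rule h_ent_le)
  fix \<delta> :: real and R F
  assume *: "\<delta> > 0" "finite R" "R \<subseteq> syms \<L>" "finite F" "E' \<subseteq> F" "F \<subseteq> B"
  have "h_loc \<L> A As N E (F \<union> E) (R \<union> R0) (min \<delta> \<delta>0) \<epsilon> \<le> h_loc \<L> A As N E' F R \<delta> \<epsilon>'"
  proof (rule h_loc_mono[OF N])
    fix r :: nat assume r: "1 \<le> r"
    show "sep_num (dist_on (As r) E) \<epsilon> (MS \<L> A (F \<union> E) (R \<union> R0) (min \<delta> \<delta>0) (As r)) \<le>
        sep_num (dist_on (As r) E') \<epsilon>' (MS \<L> A F R \<delta> (As r))"
    proof (rule sep_num_le[where f = "\<lambda>\<sigma>. restrict \<sigma> F"])
      show "(\<lambda>\<sigma>. restrict \<sigma> F) ` MS \<L> A (F \<union> E) (R \<union> R0) (min \<delta> \<delta>0) (As r) \<subseteq> MS \<L> A F R \<delta> (As r)"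
        by (auto intro: restrict_MS)
    next
      fix \<sigma> \<tau>
      assume \<sigma>: "\<sigma> \<in> MS \<L> A (F \<union> E) (R \<union> R0) (min \<delta> \<delta>0) (As r)"
        and \<tau>: "\<tau> \<in> MS \<L> A (F \<union> E) (R \<union> R0) (min \<delta> \<delta>0) (As r)"
        and "\<epsilon> \<le> dist_on (As r) E \<sigma> \<tau>"
      then have ge: "\<epsilon>' \<le> dist_on (As r) E' \<sigma> \<tau>"
        using * by (intro sep[OF r _ _ _ \<sigma> \<tau>]) auto
      then show ge': "\<epsilon>' \<le> dist_on (As r) E' (restrict \<sigma> F) (restrict \<tau> F)"
        using * by (simp add: dist_on_restrict)
      have "restrict \<sigma> F ` E' \<subseteq> univ (As r)"
        using * MS_in_univ[OF \<sigma>] by auto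
      then have "dist_on (As r) E' (restrict \<sigma> F) (restrict \<sigma> F) = 0"
        by (rule dist_on_self[OF As[OF r]])
      then show "restrict \<sigma> F \<noteq> restrict \<tau> F" using ge' \<open>\<epsilon>' > 0\<close> by auto
    qed
  qed
  then show "\<exists>\<delta>' R' F'. \<delta>' > 0 \<and> finite R' \<and> R' \<subseteq> syms \<L> \<and> finite F' \<and> E \<subseteq> F' \<and> F' \<subseteq> B \<and>
       h_loc \<L> A As N E F' R' \<delta>' \<epsilon> \<le> h_loc \<L> A As N E' F R \<delta> \<epsilon>'"
    using * E R0 \<delta>0
    by (intro exI[of _ "min \<delta> \<delta>0"] exI[of _ "R \<union> R0"] exI[of _ "F \<union> E"]) auto
qed

section \<open>Change of scale in an upper limit\<close>

text \<open>
  A modulus of continuity need not tend to \<open>0\<close>, so neither need \<open>\<phi>\<close>; where \<open>\<phi> \<epsilon>\<close> exceeds \<open>\<epsilon>\<close>, the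
  monotonicity of \<open>g\<close> allows replacing it by \<open>\<epsilon>\<close>.
\<close>

lemma Limsup_rescale:
  fixes f g :: "real \<Rightarrow> ereal" and L \<phi> :: "real \<Rightarrow> real"
  assumes anti: "\<And>\<epsilon> \<epsilon>'. 0 < \<epsilon>' \<Longrightarrow> \<epsilon>' \<le> \<epsilon> \<Longrightarrow> g \<epsilon> \<le> g \<epsilon>'"
    and le: "\<forall>\<^sub>F \<epsilon> in at_right 0. 0 < \<phi> \<epsilon> \<and> f \<epsilon> \<le> g (\<phi> \<epsilon>)"
    and L: "\<And>\<epsilon>. \<epsilon> > 0 \<Longrightarrow> L \<epsilon> > 0"
    and lim: "((\<lambda>\<epsilon>. L (\<phi> \<epsilon>) / L \<epsilon>) \<longlongrightarrow> 1) (at_right 0)"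
  shows "Limsup (at_right 0) (\<lambda>\<epsilon>. f \<epsilon> / ereal (L \<epsilon>)) \<le> Limsup (at_right 0) (\<lambda>\<epsilon>. g \<epsilon> / ereal (L \<epsilon>))"
\<comment> \<open>Testing against real upper bounds \<open>z\<close> avoids case distinctions for
  infinite upper limits.\<close>
proof (rule ereal_le_real)
  define \<psi> where "\<psi> \<epsilon> = min (\<phi> \<epsilon>) \<epsilon>" for \<epsilon>
  have pos: "\<forall>\<^sub>F \<epsilon> in at_right 0. (0::real) < \<epsilon>" by (simp add: eventually_at_right_less)
  have \<psi>: "\<forall>\<^sub>F \<epsilon> in at_right 0. 0 < \<epsilon> \<and> 0 < \<psi> \<epsilon> \<and> f \<epsilon> \<le> g (\<psi> \<epsilon>)"
    using le pos
  proof eventually_elim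
    case (elim \<epsilon>)
    then show ?case using anti[of "\<psi> \<epsilon>" "\<phi> \<epsilon>"] by (auto simp: \<psi>_def intro: order_trans)
  qed
  have "(\<psi> \<longlongrightarrow> 0) (at_right 0)"
    by (rule tendsto_sandwich[of "\<lambda>_. 0" _ _ "\<lambda>\<epsilon>. \<epsilon>"])
      (use \<psi> in \<open>auto elim!: eventually_mono simp: \<psi>_def\<close>)
  then have \<psi>_lim: "filterlim \<psi> (at_right 0) (at_right 0)"
    using \<psi> by (auto simp: filterlim_at elim: eventually_mono)
  \<comment> \<open>The quotient for \<open>\<psi>\<close> is either the quotient for
    \<open>\<phi>\<close> or exactly 1, so it inherits the limit.\<close>
  have q: "((\<lambda>\<epsilon>. L (\<psi> \<epsilon>) / L \<epsilon>) \<longlongrightarrow> 1) (at_right 0)"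
  proof (rule tendstoI)
    fix e :: real assume e: "e > 0"
    from tendstoD[OF lim e] pos show "\<forall>\<^sub>F \<epsilon> in at_right 0. dist (L (\<psi> \<epsilon>) / L \<epsilon>) 1 < e"
    proof eventually_elim
      case (elim \<epsilon>)
      then show ?case using e L[of \<epsilon>] by (auto simp: \<psi>_def min_def)
    qed
  qed
  fix z :: real
  assume z: "Limsup (at_right 0) (\<lambda>\<epsilon>. g \<epsilon> / ereal (L \<epsilon>)) \<le> ereal z"
  show "Limsup (at_right 0) (\<lambda>\<epsilon>. f \<epsilon> / ereal (L \<epsilon>)) \<le> ereal z"
  proof (rule ereal_le_epsilon2)
    fix e :: real assume e: "e > 0"
    have "Limsup (at_right 0) (\<lambda>\<epsilon>. g \<epsilon> / ereal (L \<epsilon>)) < ereal (z + e)"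
      using z e by (simp add: le_less_trans)
    then have "\<forall>\<^sub>F \<epsilon> in at_right 0. g \<epsilon> / ereal (L \<epsilon>) < ereal (z + e)"
      by (rule Limsup_lessD)
    then have "\<forall>\<^sub>F \<epsilon> in at_right 0. g (\<psi> \<epsilon>) / ereal (L (\<psi> \<epsilon>)) < ereal (z + e)"
      using \<psi>_lim by (rule eventually_compose_filterlim)
    \<comment> \<open>This is the factorization of
      \<open>g (\<psi> \<epsilon>) / L \<epsilon>\<close> into
      \<open>g (\<psi> \<epsilon>) / L (\<psi> \<epsilon>)\<close> and
      \<open>L (\<psi> \<epsilon>) / L \<epsilon>\<close>, carried out by multiplying with finite
      positive numbers, since \<open>g\<close> may be infinite.\<close>
    then have "\<forall>\<^sub>F \<epsilon> in at_right 0. f \<epsilon> / ereal (L \<epsilon>) \<le> ereal ((z + e) * (L (\<psi> \<epsilon>) / L \<epsilon>))"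
      using \<psi>
    proof eventually_elim
      case (elim \<epsilon>)
      have L': "L \<epsilon> > 0" "L (\<psi> \<epsilon>) > 0" using L elim by auto
      have "g (\<psi> \<epsilon>) \<le> ereal (L (\<psi> \<epsilon>)) * ereal (z + e)"
        using elim L' by (subst ereal_divide_le_pos[symmetric]) auto
      then have "f \<epsilon> \<le> ereal (L (\<psi> \<epsilon>)) * ereal (z + e)" using elim by (blast intro: order_trans)
      also have "\<dots> = ereal (L \<epsilon>) * ereal ((z + e) * (L (\<psi> \<epsilon>) / L \<epsilon>))" using L' by simp
      finally show ?case using L' by (subst ereal_divide_le_pos) auto
    qed
    then have "Limsup (at_right 0) (\<lambda>\<epsilon>. f \<epsilon> / ereal (L \<epsilon>)) \<le>
        Limsup (at_right 0) (\<lambda>\<epsilon>. ereal ((z + e) * (L (\<psi> \<epsilon>) / L \<epsilon>)))"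
      by (rule Limsup_mono)
    also have "\<dots> = ereal ((z + e) * 1)"
      using q by (intro lim_imp_Limsup tendsto_intros) auto
    finally show "Limsup (at_right 0) (\<lambda>\<epsilon>. f \<epsilon> / ereal (L \<epsilon>)) \<le> ereal z + ereal e" by simp
  qed
qed

section \<open>Microstates on generated elements\<close>

text \<open>Each of the two microstates respects the term \<open>t\<close> up to \<delta>; the
  triangle inequality is applied through the two evaluated terms. The list \<open>zs\<close> may be
  empty.\<close>

lemma dist_eval_le:
  assumes B: "is_structure \<L> B" and t: "wf_trm \<L> (length zs) t"
    and \<sigma>: "\<sigma> \<in> MS \<L> A F R \<delta> B" and \<tau>: "\<tau> \<in> MS \<L> A F R \<delta> B"
    and R: "TermSym (length zs) t \<in> R" and F: "set zs \<subseteq> F" "eval_trm A zs t \<in> F"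
  shows "mdist B (\<sigma> (eval_trm A zs t)) (\<tau> (eval_trm A zs t)) \<le>
      2 * \<delta> + mdist B (eval_trm B (map \<sigma> zs) t) (eval_trm B (map \<tau> zs) t)"
proof -
  interpret Metric_space "univ B" "mdist B" using B by (simp add: is_structure_def)
  let ?e = "eval_trm A zs t" and ?s = "eval_trm B (map \<sigma> zs) t" and ?t = "eval_trm B (map \<tau> zs) t"
  have in_univ: "\<sigma> ?e \<in> univ B" "\<tau> ?e \<in> univ B" "?s \<in> univ B" "?t \<in> univ B"
    using F by (auto intro!: eval_trm_in_univ[OF B t] MS_in_univ[OF \<sigma>] MS_in_univ[OF \<tau>])
  have "mdist B (\<sigma> ?e) (\<tau> ?e) \<le> mdist B (\<sigma> ?e) ?s + mdist B ?s (\<tau> ?e)"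
    using in_univ by (intro triangle)
  also have "mdist B ?s (\<tau> ?e) \<le> mdist B ?s ?t + mdist B ?t (\<tau> ?e)"
    using in_univ by (intro triangle)
  finally show ?thesis
    using microstate_dist_eval[OF \<sigma> R F] microstate_dist_eval[OF \<tau> R F] commute[of ?t "\<tau> ?e"] by simp
qed

text \<open>Domain preservation puts the images of \<open>zs\<close> under both microstates into the
  domains \<open>Ds\<close> of \<open>B\<close>. The modulus belongs to the language, so it applies
  in \<open>B\<close> to domains that were chosen in \<open>A\<close>.\<close>

lemma generated_dist_less:
  assumes B: "is_structure \<L> B" and t: "wf_trm \<L> (length zs) t" and zs: "zs \<noteq> []"
    and \<sigma>: "\<sigma> \<in> MS \<L> A F R \<delta> B" and \<tau>: "\<tau> \<in> MS \<L> A F R \<delta> B"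
    and R: "TermSym (length zs) t \<in> R" and F: "set zs \<subseteq> F" "eval_trm A zs t \<in> F"
    and Ds: "length Ds = length zs" "set Ds \<subseteq> doms \<L>"
      "\<And>i. i < length zs \<Longrightarrow> zs ! i \<in> dom_int A (Ds ! i)"
    and \<epsilon>: "\<epsilon> \<in> {0<..1}"
    and close: "\<And>z. z \<in> set zs \<Longrightarrow>
        mdist B (\<sigma> z) (\<tau> z) < modulus \<L> (TermSym (length zs) t) Ds \<epsilon>"
  shows "mdist B (\<sigma> (eval_trm A zs t)) (\<tau> (eval_trm A zs t)) < 2 * \<delta> + real (length zs) * \<epsilon>"
proof -
  have dp: "\<rho> (zs ! i) \<in> dom_int B (Ds ! i)" if "\<rho> \<in> MS \<L> A F R \<delta> B" "i < length zs" for \<rho> i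
  proof -
    have "zs ! i \<in> F" using that(2) F(1) nth_mem by blast
    moreover have "Ds ! i \<in> doms \<L>" using that(2) Ds(1,2) nth_mem[of i Ds] by auto
    ultimately show ?thesis
      using that(1) Ds(3)[OF that(2)] by (auto simp: MS_def domain_preserving_def)
  qed
  have "mdist B (eval_trm B (map \<sigma> zs) t) (eval_trm B (map \<tau> zs) t) < real (length zs) * \<epsilon>"
    by (rule eval_trm_dist_less[OF B t _ Ds(1,2) _ _ _ _ \<epsilon>])
      (simp_all add: zs dp[OF \<sigma>] dp[OF \<tau>] close)
  then show ?thesis using dist_eval_le[OF B t \<sigma> \<tau> R F] by linarith
qed

text \<open>Every microstate sends the value of a nullary term close to the value of that term in
  the target. Two microstates thus differ by at most 2\<delta> on \<open>E\<close> and are never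
  \<epsilon>-apart, so the separation condition of the transfer holds vacuously, even with no points
  on the right.\<close>

lemma h_ent_le_nullary:
  fixes \<L> :: "('f, 'g, 'D) lang"
  assumes As: "\<And>r. r \<ge> 1 \<Longrightarrow> is_structure \<L> (As r)" and N: "\<And>r. r \<ge> 1 \<Longrightarrow> N r > 0"
    and E: "finite E" "E \<subseteq> B" and \<epsilon>: "0 < \<epsilon>"
    and t: "\<And>e. e \<in> E \<Longrightarrow> wf_trm \<L> 0 (t e) \<and> eval_trm A [] (t e) = e"
  shows "h_ent \<L> A As N E B \<epsilon> \<le> h_ent \<L> A As N {} B \<epsilon>"
proof -
  define R :: "('f, 'g) sym set" where "R = (\<lambda>e. TermSym 0 (t e)) ` E"
  have R: "finite R" "R \<subseteq> syms \<L>"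
    using E t by (auto simp: R_def syms_def term_syms_def)
  show ?thesis
  proof (rule h_ent_transfer[OF N As E \<epsilon> R])
    \<comment> \<open>With this bound on \<delta> the distance is at most 2\<epsilon>/3, which is
      less than \<epsilon>.\<close>
    show "0 < \<epsilon> / 3" using \<epsilon> by simp
  next
    fix r :: nat and F R' \<delta> \<sigma> \<tau>
    assume r: "1 \<le> r" and F: "E \<union> {} \<subseteq> F" and R': "R \<subseteq> R'" and \<delta>: "\<delta> \<le> \<epsilon> / 3"
      and \<sigma>: "\<sigma> \<in> MS \<L> A F R' \<delta> (As r)" and \<tau>: "\<tau> \<in> MS \<L> A F R' \<delta> (As r)"
      and "\<epsilon> \<le> dist_on (As r) E \<sigma> \<tau>"
    then obtain e where e: "e \<in> E" "mdist (As r) (\<sigma> e) (\<tau> e) \<ge> \<epsilon>"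
      using dist_on_attained[OF E(1) \<epsilon>] by metis
    interpret Metric_space "univ (As r)" "mdist (As r)" using As[OF r] by (simp add: is_structure_def)
    have "eval_trm (As r) [] (t e) \<in> univ (As r)"
      using eval_trm_in_univ[OF As[OF r], of 0 "t e" "[]"] t[OF e(1)] by simp
    then have "mdist (As r) (eval_trm (As r) [] (t e)) (eval_trm (As r) [] (t e)) = 0"
      by (rule mdist_zero)
    moreover have "TermSym 0 (t e) \<in> R'" "e \<in> F" using e(1) R' F by (auto simp: R_def)
    ultimately have "mdist (As r) (\<sigma> e) (\<tau> e) \<le> 2 * \<delta>"
      using dist_eval_le[OF As[OF r] _ \<sigma> \<tau>, of "[]" "t e"] t[OF e(1)] by simp
    then show "\<epsilon> \<le> dist_on (As r) {} \<sigma> \<tau>" using e(2) \<delta> \<epsilon> by linarith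
  qed
qed

text \<open>By contraposition: microstates closer than \<epsilon>' at all points of
  \<open>zs\<close> are closer than \<epsilon> on \<open>E\<close>.\<close>

lemma h_ent_le_generators:
  fixes \<L> :: "('f, 'g, 'D) lang"
  assumes As: "\<And>r. r \<ge> 1 \<Longrightarrow> is_structure \<L> (As r)" and N: "\<And>r. r \<ge> 1 \<Longrightarrow> N r > 0"
    and E: "finite E" "E \<subseteq> B" and \<epsilon>: "0 < \<epsilon>" "\<epsilon> \<le> 1" and zs: "zs \<noteq> []"
    and t: "\<And>e. e \<in> E \<Longrightarrow> wf_trm \<L> (length zs) (t e) \<and> eval_trm A zs (t e) = e"
    and Ds: "length Ds = length zs" "set Ds \<subseteq> doms \<L>"
      "\<And>i. i < length zs \<Longrightarrow> zs ! i \<in> dom_int A (Ds ! i)"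
    and \<epsilon>': "0 < \<epsilon>'" "\<And>e. e \<in> E \<Longrightarrow>
      \<epsilon>' \<le> modulus \<L> (TermSym (length zs) (t e)) Ds (\<epsilon> / (2 * real (length zs)))"
  shows "h_ent \<L> A As N E B \<epsilon> \<le> h_ent \<L> A As N (set zs) B \<epsilon>'"
proof -
  define R :: "('f, 'g) sym set" where "R = (\<lambda>e. TermSym (length zs) (t e)) ` E"
  have R: "finite R" "R \<subseteq> syms \<L>"
    using E t by (auto simp: R_def syms_def term_syms_def)
  have n: "real (length zs) \<ge> 1" using zs by (cases zs) auto
  then have \<epsilon>n: "\<epsilon> / (2 * real (length zs)) \<in> {0<..1}" using \<epsilon> by (auto simp: divide_simps)
  show ?thesis
  proof (rule h_ent_transfer[OF N As E \<epsilon>'(1) R])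
    \<comment> \<open>The two microstate errors add up to at most \<epsilon>/2. Changing the
      arguments costs strictly less than \<epsilon>/2, namely \<epsilon>/(2n) for each of the n
      entries of \<open>zs\<close>.\<close>
    show "0 < \<epsilon> / 4" using \<epsilon> by simp
  next
    fix r :: nat and F R' \<delta> \<sigma> \<tau>
    assume r: "1 \<le> r" and F: "E \<union> set zs \<subseteq> F" and R': "R \<subseteq> R'" and \<delta>: "\<delta> \<le> \<epsilon> / 4"
      and \<sigma>: "\<sigma> \<in> MS \<L> A F R' \<delta> (As r)" and \<tau>: "\<tau> \<in> MS \<L> A F R' \<delta> (As r)"
      and "\<epsilon> \<le> dist_on (As r) E \<sigma> \<tau>"
    then obtain e where e: "e \<in> E" "mdist (As r) (\<sigma> e) (\<tau> e) \<ge> \<epsilon>"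
      using dist_on_attained[OF E(1) \<epsilon>(1)] by metis
    have wf: "wf_trm \<L> (length zs) (t e)" and ev: "eval_trm A zs (t e) = e" using t[OF e(1)] by auto
    have R'e: "TermSym (length zs) (t e) \<in> R'" and zsF: "set zs \<subseteq> F" and eF: "eval_trm A zs (t e) \<in> F"
      using e(1) R' F ev by (auto simp: R_def)
    show "\<epsilon>' \<le> dist_on (As r) (set zs) \<sigma> \<tau>"
    proof (rule ccontr)
      assume small: "\<not> ?thesis"
      have "mdist (As r) (\<sigma> z) (\<tau> z) <
          modulus \<L> (TermSym (length zs) (t e)) Ds (\<epsilon> / (2 * real (length zs)))"
        if "z \<in> set zs" for z
        using small \<epsilon>'(2)[OF e(1)] mdist_le_dist_on[OF finite_set that, of "As r" \<sigma> \<tau>] by linarith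
      from generated_dist_less[OF As[OF r] wf zs \<sigma> \<tau> R'e zsF eF Ds \<epsilon>n this]
      have "mdist (As r) (\<sigma> e) (\<tau> e) < 2 * \<delta> + real (length zs) * (\<epsilon> / (2 * real (length zs)))"
        unfolding ev .
      also have "real (length zs) * (\<epsilon> / (2 * real (length zs))) = \<epsilon> / 2" using zs by simp
      finally show False using e(2) \<delta> by linarith
    qed
  qed
qed

section \<open>Independence of the dimension from the generators\<close>

text \<open>Both dimensions use the same substructure, so only the finite set \<open>E\<close> has
  to be exchanged: each one in \<open>G\<^sub>1\<close> is dominated by the set of its generators in
  \<open>G\<^sub>2\<close>. The reverse inequality follows by symmetry.\<close>

lemma entropy_dim_le:
  fixes \<L> :: "('f, 'g, 'D) lang"
    and A :: "('f, 'g, 'D, 'a) struct"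
    and As :: "nat \<Rightarrow> ('f, 'g, 'D, 'b) struct"
  assumes lang: "is_language \<L>" and A: "is_structure \<L> A"
    and G: "G\<^sub>2 \<subseteq> univ A"
    and gen: "values_of A (term_syms \<L>) G\<^sub>1 = values_of A (term_syms \<L>) G\<^sub>2"
    and As: "\<And>r. r \<ge> 1 \<Longrightarrow> is_structure \<L> (As r)"
    and N: "\<And>r. r \<ge> 1 \<Longrightarrow> N r > 0" and L: "\<And>\<epsilon>. \<epsilon> > 0 \<Longrightarrow> L \<epsilon> > 0"
    and lim: "\<And>\<eta> c. \<eta> \<in> continuity_symbols \<L> \<Longrightarrow> c \<in> {0<..<1} \<Longrightarrow>
           ((\<lambda>\<epsilon>. L (\<eta> (c * \<epsilon>) / 2) / L \<epsilon>) \<longlongrightarrow> 1) (at_right 0)"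
  shows "entropy_dim \<L> A As N L G\<^sub>1 \<le> entropy_dim \<L> A As N L G\<^sub>2"
  unfolding entropy_dim_def gen
proof (rule SUP_least)
  let ?B = "values_of A (term_syms \<L>) G\<^sub>2"
  let ?h = "\<lambda>E. h_ent \<L> A As N E ?B"
  fix E assume "E \<in> {E. finite E \<and> E \<subseteq> G\<^sub>1}"
  then have E: "finite E" "E \<subseteq> ?B" using subset_values_of[of G\<^sub>1 A \<L>] gen by auto
  obtain zs t where zs: "set zs \<subseteq> G\<^sub>2"
    and t: "\<And>e. e \<in> E \<Longrightarrow> wf_trm \<L> (length zs) (t e) \<and> eval_trm A zs (t e) = e"
    using finite_generating_list[OF E] by blast
  define n where "n = length zs"
  \<comment> \<open>The function \<open>\<phi>\<close> is the change of scale: the identity if no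
    generators occur, and \<open>\<eta> (c * \<epsilon>) / 2\<close> otherwise.\<close>
  have "\<exists>\<phi>. ((\<lambda>\<epsilon>. L (\<phi> \<epsilon>) / L \<epsilon>) \<longlongrightarrow> 1) (at_right 0) \<and>
      (\<forall>\<epsilon>. 0 < \<epsilon> \<and> \<epsilon> < 1 \<longrightarrow> 0 < \<phi> \<epsilon> \<and> ?h E \<epsilon> \<le> ?h (set zs) (\<phi> \<epsilon>))"
  proof (cases "zs = []")
    case True
    have "\<forall>\<^sub>F \<epsilon> in at_right 0. 1 = L \<epsilon> / L \<epsilon>"
      using eventually_at_right_less[of "0::real"] by eventually_elim (use L in force)
    then have "((\<lambda>\<epsilon>. L \<epsilon> / L \<epsilon>) \<longlongrightarrow> 1) (at_right 0)"
      by (rule Lim_transform_eventually[OF tendsto_const])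
    moreover have "?h E \<epsilon> \<le> ?h (set zs) \<epsilon>" if "0 < \<epsilon>" for \<epsilon>
      using h_ent_le_nullary[OF As N E that, where t = t] t True by simp
    ultimately show ?thesis by (intro exI[of _ "\<lambda>\<epsilon>. \<epsilon>"]) simp
  next
    case False
    then have n: "n > 0" by (simp add: n_def)
    \<comment> \<open>The domains exhaust \<open>A\<close>, so each generator can be assigned one;
      this fixes the list \<open>Ds\<close> at which the moduli are taken.\<close>
    have "\<exists>D\<in>doms \<L>. z \<in> dom_int A D" if "z \<in> set zs" for z
    proof -
      have "z \<in> (\<Union>D\<in>doms \<L>. dom_int A D)"
        using that zs G A by (auto simp: is_structure_def)
      then show ?thesis by blast
    qed
    then obtain D where D: "\<And>z. z \<in> set zs \<Longrightarrow> D z \<in> doms \<L> \<and> z \<in> dom_int A (D z)" by metis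
    define Ds where "Ds = map D zs"
    have Ds: "length Ds = n" "set Ds \<subseteq> doms \<L>" "\<And>i. i < n \<Longrightarrow> zs ! i \<in> dom_int A (Ds ! i)"
      using D by (auto simp: Ds_def n_def)
    \<comment> \<open>The projection only serves to make \<open>T\<close> nonempty.\<close>
    define T :: "('f, 'g) sym set" where
      "T = insert (TermSym n (Var 0)) ((\<lambda>e. TermSym n (t e)) ` E)"
    have T: "finite T" "T \<noteq> {}" "T \<subseteq> syms \<L>" "\<And>s. s \<in> T \<Longrightarrow> sym_arity \<L> s = n"
      using E t n by (auto simp: T_def syms_def term_syms_def n_def)
    define \<eta> where "\<eta> = (\<lambda>\<epsilon>. Min ((\<lambda>s. modulus \<L> s Ds \<epsilon>) ` T))"
    \<comment> \<open>Each of the n arguments receives the share \<epsilon>/(2n) of the allowed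
      error; n > 0 gives c < 1.\<close>
    define c where "c = 1 / (2 * real n)"
    have c: "c \<in> {0<..<1}" using n by (auto simp: c_def divide_simps)
    have "\<eta> \<in> continuity_symbols \<L>"
      unfolding continuity_symbols_def \<eta>_def mem_Collect_eq
      by (rule exI[of _ T], rule exI[of _ Ds], rule exI[of _ n]) (use T Ds n in simp)
    then have "((\<lambda>\<epsilon>. L (\<eta> (c * \<epsilon>) / 2) / L \<epsilon>) \<longlongrightarrow> 1) (at_right 0)" using c by (rule lim)
    moreover have "0 < \<eta> (c * \<epsilon>) / 2 \<and> ?h E \<epsilon> \<le> ?h (set zs) (\<eta> (c * \<epsilon>) / 2)"
      if \<epsilon>: "0 < \<epsilon>" "\<epsilon> < 1" for \<epsilon>
    proof
      have "c * \<epsilon> \<le> 1" using c \<epsilon> by (intro mult_le_one) auto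
      then have c\<epsilon>: "c * \<epsilon> \<in> {0<..1}" using c \<epsilon> by simp
      have "modulus \<L> s Ds (c * \<epsilon>) > 0" if "s \<in> T" for s
      proof -
        have "\<forall>Ds. sym_arity \<L> s > 0 \<and> length Ds = sym_arity \<L> s \<and> set Ds \<subseteq> doms \<L> \<longrightarrow>
            modulus \<L> s Ds \<in> {0<..1} \<rightarrow> {0<..1}"
          using lang that T(3) unfolding is_language_def by blast
        then have "modulus \<L> s Ds \<in> {0<..1} \<rightarrow> {0<..1}"
          using T(4)[OF that] Ds(1,2) n by simp
        from funcset_mem[OF this c\<epsilon>] show ?thesis by simp
      qed
      then show pos: "0 < \<eta> (c * \<epsilon>) / 2" using T(1,2) by (simp add: \<eta>_def)
      \<comment> \<open>Since \<open>\<eta> (c * \<epsilon>)\<close> is positive, halving it only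
        lowers it; the half matches the form of the hypothesis on \<open>L\<close>.\<close>
      have "\<eta> (c * \<epsilon>) / 2 \<le> modulus \<L> (TermSym (length zs) (t e)) Ds (\<epsilon> / (2 * real (length zs)))"
        if "e \<in> E" for e
      proof -
        have "\<eta> (c * \<epsilon>) \<le> modulus \<L> (TermSym n (t e)) Ds (c * \<epsilon>)"
          unfolding \<eta>_def using T(1) that by (intro Min_le) (auto simp: T_def)
        then show ?thesis using pos by (simp add: c_def n_def)
      qed
      then show "?h E \<epsilon> \<le> ?h (set zs) (\<eta> (c * \<epsilon>) / 2)"
        using \<epsilon> Ds pos unfolding n_def
        by (intro h_ent_le_generators[OF As N E _ _ False t]) simp_all
    qed
    ultimately show ?thesis by (intro exI[of _ "\<lambda>\<epsilon>. \<eta> (c * \<epsilon>) / 2"]) blast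
  qed
  then obtain \<phi> where \<phi>: "((\<lambda>\<epsilon>. L (\<phi> \<epsilon>) / L \<epsilon>) \<longlongrightarrow> 1) (at_right 0)"
    "\<And>\<epsilon>. 0 < \<epsilon> \<Longrightarrow> \<epsilon> < 1 \<Longrightarrow> 0 < \<phi> \<epsilon> \<and> ?h E \<epsilon> \<le> ?h (set zs) (\<phi> \<epsilon>)"
    by blast
  have "\<forall>\<^sub>F \<epsilon> in at_right 0. 0 < \<phi> \<epsilon> \<and> ?h E \<epsilon> \<le> ?h (set zs) (\<phi> \<epsilon>)"
    unfolding eventually_at_right_field using \<phi>(2) by (intro exI[of _ 1]) simp
  then have "Limsup (at_right 0) (\<lambda>\<epsilon>. ?h E \<epsilon> / ereal (L \<epsilon>)) \<le>
      Limsup (at_right 0) (\<lambda>\<epsilon>. ?h (set zs) \<epsilon> / ereal (L \<epsilon>))"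
    by (intro Limsup_rescale[where \<phi> = \<phi>] h_ent_antimono N As L \<phi>(1))
  also have "\<dots> \<le> (SUP E\<in>{E. finite E \<and> E \<subseteq> G\<^sub>2}.
      Limsup (at_right 0) (\<lambda>\<epsilon>. ?h E \<epsilon> / ereal (L \<epsilon>)))"
    using zs by (intro SUP_upper) auto
  finally show "Limsup (at_right 0) (\<lambda>\<epsilon>. ?h E \<epsilon> / ereal (L \<epsilon>)) \<le>
      (SUP E\<in>{E. finite E \<and> E \<subseteq> G\<^sub>2}. Limsup (at_right 0) (\<lambda>\<epsilon>. ?h E \<epsilon> / ereal (L \<epsilon>)))" .
qed

theorem theorem9:
  fixes \<L> :: "('f, 'g, 'D) lang"
    and A :: "('f, 'g, 'D, 'a) struct"
    and As :: "nat \<Rightarrow> ('f, 'g, 'D, 'b) struct"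
    and N :: "nat \<Rightarrow> real"
    and L :: "real \<Rightarrow> real"
    and G\<^sub>1 G\<^sub>2 :: "'a set"
  assumes "is_language \<L>"
    and "is_structure \<L> A"
    and "G\<^sub>1 \<subseteq> univ A"
    and "G\<^sub>2 \<subseteq> univ A"
    and "values_of A (term_syms \<L>) G\<^sub>1 = values_of A (term_syms \<L>) G\<^sub>2"
    and "\<And>r. r \<ge> 1 \<Longrightarrow> is_structure \<L> (As r)"
    and "\<And>r. r \<ge> 1 \<Longrightarrow> N r > 0"
    and "\<And>\<epsilon>. \<epsilon> > 0 \<Longrightarrow> L \<epsilon> > 0"
    and "\<And>\<eta> c. \<eta> \<in> continuity_symbols \<L> \<Longrightarrow> c \<in> {0<..<1} \<Longrightarrow>
           ((\<lambda>\<epsilon>. L (\<eta> (c * \<epsilon>) / 2) / L \<epsilon>) \<longlongrightarrow> 1) (at_right 0)"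
  shows "entropy_dim \<L> A As N L G\<^sub>1 = entropy_dim \<L> A As N L G\<^sub>2"
  by (intro antisym entropy_dim_le[OF assms(1,2,4-9)]
      entropy_dim_le[OF assms(1-3) assms(5)[symmetric] assms(6-9)])

end
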